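(* For every $n\in\mathbb N$, in the Euclidean space $X=\mathbb R^n$ (endowed with the coarse structure generated by the Euclidean metric) the ideal $\mathcal S(X)$ of small subsets of $X$ coincides with the ideal $\mathcal D_<(X)=\{A\subset X:\operatorname{asdim}(A)<\operatorname{asdim}(X)\}$.
   Context: A coarse space is a pair $(X,\mathcal E)$ where $\mathcal E$ is a family of subsets of $X\times X$ (entourages) such that: each $\varepsilon\in\mathcal E$ contains the diagonal $\Delta_X$ and satisfies $\varepsilon=\varepsilon^{-1}$; for any $\varepsilon,\delta\in\mathcal E$ some $\eta\in\mathcal E$ contains $\delta\circ\varepsilon=\{(x,z):\exists y\,(x,y)\in\varepsilon,(y,z)\in\delta\}$; and any $\delta$ with $\Delta_X\subset\delta=\delta^{-1}\subset\varepsilon$ for some $\varepsilon\in\mathcal E$ belongs to $\mathcal E$. A metric $d$ on $X$ generates the coarse structure with base $\{\{(x,y):d(x,y)<r\}:0\le r<\infty\}$. Each $A\subset X$ carries the subspace coarse structure $\{\varepsilon\cap A^2:\varepsilon\in\mathcal E\}$. For $x\in X$, $A\subset X$: $B(x,\varepsilon)=\{y:(x,y)\in\varepsilon\}$, $B(A,\varepsilon)=\bigcup_{a\in A}B(a,\varepsilon)$. For a family $\mathcal U$ of subsets, $\operatorname{mesh}(\mathcal U)=\bigcup_{U\in\mathcal U}U\times U$. The asymptotic dimension $\operatorname{asdim}(X)$ is the least $n\in\omega$ such that for every $\varepsilon\in\mathcal E$ there is a cover $\mathcal U$ of $X$ with $\operatorname{mesh}(\mathcal U)\subset\delta$ for some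 $\delta\in\mathcal E$ and each ball $B(x,\varepsilon)$ meeting at most $n+1$ members of $\mathcal U$ ($\infty$ if no such $n$ exists). A set $A\subset X$ is large if $B(A,\varepsilon)=X$ for some $\varepsilon\in\mathcal E$, and small if $L\setminus A$ is large for every large $L\subset X$; $\mathcal S(X)$ is the family of small subsets. The asymptotic dimension of a subset is computed with respect to its subspace coarse structure. *)

theory Defs
  imports "HOL-Analysis.Analysis" "HOL-Library.Extended_Nat"
begin

definition coarse_space :: "'a set \<Rightarrow> ('a \<times> 'a) set set \<Rightarrow> bool" where
  "coarse_space X E \<longleftrightarrow>
     (\<forall>e\<in>E. Id_on X \<subseteq> e \<and> e = e\<inverse> \<and> e \<subseteq> X \<times> X) \<and>
     (\<forall>e\<in>E. \<forall>d\<in>E. \<exists>h\<in>E. e O d \<subseteq> h) \<and>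
     (\<forall>d. (Id_on X \<subseteq> d \<and> d = d\<inverse> \<and> (\<exists>e\<in>E. d \<subseteq> e)) \<longrightarrow> d \<in> E)"

definition metric_coarse :: "'a::metric_space set \<Rightarrow> ('a \<times> 'a) set set" where
  "metric_coarse X = {e. Id_on X \<subseteq> e \<and> e = e\<inverse> \<and>
      (\<exists>r\<ge>0. e \<subseteq> {(x,y). x \<in> X \<and> y \<in> X \<and> dist x y < r})}"

definition subspace_coarse :: "('a \<times> 'a) set set \<Rightarrow> 'a set \<Rightarrow> ('a \<times> 'a) set set" where
  "subspace_coarse E A = (\<lambda>e. e \<inter> (A \<times> A)) ` E"

definition cball_at :: "'a \<Rightarrow> ('a \<times> 'a) set \<Rightarrow> 'a set" where
  "cball_at x e = {y. (x, y) \<in> e}"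

definition cball_set :: "'a set \<Rightarrow> ('a \<times> 'a) set \<Rightarrow> 'a set" where
  "cball_set A e = (\<Union>a\<in>A. cball_at a e)"

definition mesh :: "'a set set \<Rightarrow> ('a \<times> 'a) set" where
  "mesh \<U> = (\<Union>U\<in>\<U>. U \<times> U)"

definition asdim_le :: "'a set \<Rightarrow> ('a \<times> 'a) set set \<Rightarrow> nat \<Rightarrow> bool" where
  "asdim_le X E n \<longleftrightarrow>
     (\<forall>e\<in>E. \<exists>\<U>. \<Union>\<U> = X \<and> (\<exists>d\<in>E. mesh \<U> \<subseteq> d) \<and>
        (\<forall>x\<in>X. finite {U\<in>\<U>. cball_at x e \<inter> U \<noteq> {}} \<and>
                 card {U\<in>\<U>. cball_at x e \<inter> U \<noteq> {}} \<le> n + 1))"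

definition asdim :: "'a set \<Rightarrow> ('a \<times> 'a) set set \<Rightarrow> enat" where
  "asdim X E = (if \<exists>n. asdim_le X E n then enat (LEAST n. asdim_le X E n) else \<infinity>)"

definition large :: "'a set \<Rightarrow> ('a \<times> 'a) set set \<Rightarrow> 'a set \<Rightarrow> bool" where
  "large X E A \<longleftrightarrow> A \<subseteq> X \<and> (\<exists>e\<in>E. cball_set A e = X)"

definition small_sets :: "'a set \<Rightarrow> ('a \<times> 'a) set set \<Rightarrow> 'a set set" where
  "small_sets X E = {A. A \<subseteq> X \<and> (\<forall>L. large X E L \<longrightarrow> large X E (L - A))}"

definition D_less :: "'a set \<Rightarrow> ('a \<times> 'a) set set \<Rightarrow> 'a set set" where
  "D_less X E = {A. A \<subseteq> X \<and> asdim A (subspace_coarse E A) < asdim X E}"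

end

theory Submission
  imports Defs
begin

text \<open>
  A set \<open>A\<close> is small iff it is porous at every scale: for each \<open>R\<close> there is \<open>S\<close> such that every ball
  of radius \<open>S\<close> contains the centre of a ball of radius \<open>R\<close> missing \<open>A\<close>. Let \<open>n\<close> be the dimension.

  If \<open>A\<close> is not porous, then \<open>A\<close> is \<open>R\<close>-dense in arbitrarily large balls for some \<open>R\<close>, so a bounded
  cover of \<open>A\<close> of multiplicity \<open>n\<close> fattens to an open cover of multiplicity \<open>n\<close> of a ball much
  larger than its members, which Lebesgue's covering theorem forbids.

  Conversely, split the space according to the cell of a large cubical grid whose neighbourhood
  contains the point, with neighbourhoods of cells getting thinner as their dimension grows. This
  gives \<open>n + 1\<close> colours \<open>0, \<dots>, n\<close> (the dimension of the cell), and colour \<open>0\<close> occurs only near the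
  vertices. If \<open>A\<close> is porous, a Lipschitz map at bounded distance from the identity moves holes of
  \<open>A\<close> onto the vertices, so that pulling back the colouring leaves only \<open>n\<close> colours on \<open>A\<close>.
\<close>

section \<open>Metric coarse structures\<close>

lemma ball_entourage_in_metric_coarse:
  fixes r :: real
  assumes "r > 0"
  shows "{(x, y). dist x y < r} \<in> metric_coarse (UNIV :: 'a::metric_space set)"
  using assms unfolding metric_coarse_def
  by (auto simp: dist_commute intro!: exI[of _ r])

lemma metric_coarse_bounded:
  fixes e :: "('a::metric_space \<times> 'a) set"
  assumes "e \<in> metric_coarse UNIV"
  shows "\<exists>r>0. \<forall>x y. (x, y) \<in> e \<longrightarrow> dist x y < r"
proof -
  obtain r where r: "r \<ge> 0" "e \<subseteq> {(x, y). dist x y < r}"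
    using assms unfolding metric_coarse_def by auto
  then have "dist x y < r + 1" if "(x, y) \<in> e" for x y
    using that by fastforce
  then show ?thesis
    using r(1) by (intro exI[of _ "r + 1"]) auto
qed

lemma subspace_coarse_UNIV [simp]: "subspace_coarse E UNIV = E"
  by (simp add: subspace_coarse_def)

lemma large_metric_iff:
  fixes L :: "'a::metric_space set"
  shows "large UNIV (metric_coarse UNIV) L \<longleftrightarrow> (\<exists>r>0. \<forall>x. \<exists>a\<in>L. dist a x < r)"
proof
  assume "large UNIV (metric_coarse UNIV) L"
  then obtain e where e: "e \<in> metric_coarse UNIV" "cball_set L e = UNIV"
    by (auto simp: large_def)
  obtain r where "r > 0" "\<And>x y. (x, y) \<in> e \<Longrightarrow> dist x y < r"
    using metric_coarse_bounded[OF e(1)] by blast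
  with e(2) show "\<exists>r>0. \<forall>x. \<exists>a\<in>L. dist a x < r"
    unfolding cball_set_def cball_at_def by blast
next
  assume "\<exists>r>0. \<forall>x. \<exists>a\<in>L. dist a x < r"
  then obtain r where r: "r > 0" "\<And>x. \<exists>a\<in>L. dist a x < r"
    by blast
  then have "cball_set L {(x, y). dist x y < r} = UNIV"
    unfolding cball_set_def cball_at_def by blast
  then show "large UNIV (metric_coarse UNIV) L"
    using ball_entourage_in_metric_coarse[OF r(1)] unfolding large_def by blast
qed

text \<open>Smallness is tested on one large set: \<open>A\<close> together with all centres of
  \<open>R\<close>-holes. Conversely, an \<open>R\<close>-dense set has a point in every
  \<open>R\<close>-hole, and that point survives the removal of \<open>A\<close>.\<close>

lemma small_sets_metric_iff:
  fixes A :: "'a::metric_space set"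
  shows "A \<in> small_sets UNIV (metric_coarse UNIV) \<longleftrightarrow>
    (\<forall>R>0. \<exists>S>0. \<forall>x. \<exists>y. dist x y < S \<and> ball y R \<inter> A = {})"
proof (intro iffI allI impI)
  fix R :: real
  assume small: "A \<in> small_sets UNIV (metric_coarse UNIV)" and R: "R > 0"
  \<comment> \<open>\<open>L\<close> is large, and \<open>L - A\<close> consists of the centres of the holes\<close>
  define L where "L = {x. ball x R \<inter> A = {}} \<union> A"
  have "\<exists>a\<in>L. dist a x < R" for x
  proof (cases "ball x R \<inter> A = {}")
    case True
    then show ?thesis using R by (intro bexI[of _ x]) (auto simp: L_def)
  next
    case False
    then obtain a where "a \<in> A" "dist x a < R" by auto
    then show ?thesis by (auto simp: L_def dist_commute)
  qed
  then have "large UNIV (metric_coarse UNIV) L"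
    using R by (auto simp: large_metric_iff)
  then have "large UNIV (metric_coarse UNIV) (L - A)"
    using small by (simp add: small_sets_def)
  then obtain S where S: "S > 0" "\<forall>x. \<exists>a\<in>L - A. dist a x < S"
    by (auto simp: large_metric_iff)
  have "\<exists>y. dist x y < S \<and> ball y R \<inter> A = {}" for x
  proof -
    obtain a where "a \<in> L - A" "dist a x < S" using S(2) by blast
    then show ?thesis by (auto simp: L_def dist_commute)
  qed
  with S(1) show "\<exists>S>0. \<forall>x. \<exists>y. dist x y < S \<and> ball y R \<inter> A = {}"
    by blast
next
  assume porous: "\<forall>R>0. \<exists>S>0. \<forall>x. \<exists>y. dist x y < S \<and> ball y R \<inter> A = {}"
  have "large UNIV (metric_coarse UNIV) (L - A)" if L: "large UNIV (metric_coarse UNIV) L" for L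
  proof -
    obtain R where R: "R > 0" "\<forall>x. \<exists>a\<in>L. dist a x < R"
      using L unfolding large_metric_iff by blast
    obtain S where S: "S > 0" "\<forall>x. \<exists>y. dist x y < S \<and> ball y R \<inter> A = {}"
      using porous R(1) by blast
    have "\<exists>a\<in>L - A. dist a x < R + S" for x
    proof -
      obtain y where y: "dist x y < S" "ball y R \<inter> A = {}" using S(2) by blast
      obtain a where a: "a \<in> L" "dist a y < R" using R(2) by blast
      have "a \<notin> A" using y(2) a(2) by (simp add: disjoint_iff dist_commute)
      moreover have "dist a x < R + S"
        using y(1) a(2) dist_triangle[of a x y] by (simp add: dist_commute)
      ultimately show ?thesis using a(1) by blast
    qed
    then show ?thesis
      using R(1) S(1) by (auto simp: large_metric_iff intro!: exI[of _ "R + S"])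
  qed
  then show "A \<in> small_sets UNIV (metric_coarse UNIV)"
    by (simp add: small_sets_def)
qed

section \<open>Asymptotic dimension in metric terms\<close>

lemma asdim_le_mono:
  assumes "asdim_le X E m" "m \<le> n"
  shows "asdim_le X E n"
  unfolding asdim_le_def
proof
  fix e assume "e \<in> E"
  then obtain \<U> where \<U>: "\<Union>\<U> = X" "\<exists>d\<in>E. mesh \<U> \<subseteq> d"
    and count: "\<And>x. x \<in> X \<Longrightarrow> finite {U\<in>\<U>. cball_at x e \<inter> U \<noteq> {}} \<and>
      card {U\<in>\<U>. cball_at x e \<inter> U \<noteq> {}} \<le> m + 1"
    using assms(1) unfolding asdim_le_def by meson
  have "finite {U\<in>\<U>. cball_at x e \<inter> U \<noteq> {}} \<and> card {U\<in>\<U>. cball_at x e \<inter> U \<noteq> {}} \<le> n + 1"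
    if "x \<in> X" for x
    using count[OF that] assms(2) by linarith
  with \<U> show "\<exists>\<U>. \<Union>\<U> = X \<and> (\<exists>d\<in>E. mesh \<U> \<subseteq> d) \<and>
      (\<forall>x\<in>X. finite {U\<in>\<U>. cball_at x e \<inter> U \<noteq> {}} \<and> card {U\<in>\<U>. cball_at x e \<inter> U \<noteq> {}} \<le> n + 1)"
    by blast
qed

text \<open>Since \<open>asdim_le\<close> is upward closed, the single test at \<open>n - 1\<close>
  decides. At \<open>n = 0\<close> truncated subtraction would test \<open>0\<close> instead, hence
  the assumption.\<close>

lemma asdim_less_iff:
  assumes "n > 0"
  shows "asdim X E < enat n \<longleftrightarrow> asdim_le X E (n - 1)"
proof
  assume *: "asdim X E < enat n"
  then have ex: "\<exists>m. asdim_le X E m" and less: "(LEAST m. asdim_le X E m) < n"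
    by (auto simp: asdim_def split: if_splits)
  from less have "(LEAST m. asdim_le X E m) \<le> n - 1" by linarith
  then show "asdim_le X E (n - 1)"
    by (rule asdim_le_mono[OF LeastI_ex[OF ex]])
next
  assume *: "asdim_le X E (n - 1)"
  then have "(LEAST m. asdim_le X E m) \<le> n - 1" by (rule Least_le)
  then have "(LEAST m. asdim_le X E m) < n" using assms by linarith
  moreover have "asdim X E = enat (LEAST m. asdim_le X E m)"
    unfolding asdim_def using * by (metis (no_types))
  ultimately show "asdim X E < enat n" by simp
qed

lemma asdim_le_metric_subspaceD:
  fixes A :: "'a::metric_space set"
  assumes "asdim_le A (subspace_coarse (metric_coarse UNIV) A) m" "r > 0"
  shows "\<exists>\<U> D. D > 0 \<and> \<Union>\<U> = A \<and> (\<forall>U\<in>\<U>. \<forall>x\<in>U. \<forall>y\<in>U. dist x y < D) \<and>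
    (\<forall>x\<in>A. finite {U\<in>\<U>. ball x r \<inter> U \<noteq> {}} \<and> card {U\<in>\<U>. ball x r \<inter> U \<noteq> {}} \<le> m + 1)"
proof -
  define e where "e = {(x, y). dist x y < r} \<inter> A \<times> A"
  have "e \<in> subspace_coarse (metric_coarse UNIV) A"
    unfolding subspace_coarse_def e_def
    using ball_entourage_in_metric_coarse[OF assms(2)] by blast
  then obtain \<U> d where \<U>: "\<Union>\<U> = A" "d \<in> subspace_coarse (metric_coarse UNIV) A" "mesh \<U> \<subseteq> d"
    and count: "\<And>x. x \<in> A \<Longrightarrow> finite {U\<in>\<U>. cball_at x e \<inter> U \<noteq> {}} \<and>
                 card {U\<in>\<U>. cball_at x e \<inter> U \<noteq> {}} \<le> m + 1"
    using assms(1) unfolding asdim_le_def by meson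
  obtain d' where d': "d' \<in> metric_coarse UNIV" "d \<subseteq> d'"
    using \<U>(2) by (auto simp: subspace_coarse_def)
  obtain D where D: "D > 0" "\<And>x y. (x, y) \<in> d' \<Longrightarrow> dist x y < D"
    using metric_coarse_bounded[OF d'(1)] by blast
  have "dist x y < D" if "U \<in> \<U>" "x \<in> U" "y \<in> U" for U x y
    using that \<U>(3) d'(2) D(2) by (auto simp: mesh_def)
  \<comment> \<open>Members of the cover lie in \<open>A\<close>, so balls of the whole space and
    balls of \<open>A\<close> meet the same ones.\<close>
  moreover have eq: "{U\<in>\<U>. cball_at x e \<inter> U \<noteq> {}} = {U\<in>\<U>. ball x r \<inter> U \<noteq> {}}" if "x \<in> A" for x
    using that \<U>(1) by (auto simp: cball_at_def e_def)
  ultimately show ?thesis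
    using D(1) \<U>(1) count by (intro exI[of _ \<U>] exI[of _ D] conjI ballI) simp_all
qed

text \<open>
  Points of the same colour with different labels are far apart, so a ball meets at most one
  label class of each colour.
\<close>

lemma asdim_le_metric_subspaceI:
  fixes A :: "'a::metric_space set"
  assumes "\<And>r. r > 0 \<Longrightarrow> \<exists>(col :: 'a \<Rightarrow> nat) (lab :: 'a \<Rightarrow> 'b) I D. finite I \<and> card I \<le> m + 1 \<and> col ` A \<subseteq> I \<and>
      (\<forall>x\<in>A. \<forall>y\<in>A. dist x y < r \<longrightarrow> col x = col y \<longrightarrow> lab x = lab y) \<and>
      (\<forall>x\<in>A. \<forall>y\<in>A. lab x = lab y \<longrightarrow> dist x y < D)"
  shows "asdim_le A (subspace_coarse (metric_coarse UNIV) A) m"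
  unfolding asdim_le_def
proof
  fix e assume "e \<in> subspace_coarse (metric_coarse UNIV) A"
  then obtain e' where e': "e' \<in> metric_coarse UNIV" "e = e' \<inter> A \<times> A"
    by (auto simp: subspace_coarse_def)
  obtain r where r: "r > 0" "\<And>x y. (x, y) \<in> e' \<Longrightarrow> dist x y < r"
    using metric_coarse_bounded[OF e'(1)] by blast
  \<comment> \<open>Two points of one \<open>r\<close>-ball are less than \<open>2 * r\<close>
    apart, hence the doubled scale.\<close>
  obtain col :: "'a \<Rightarrow> nat" and lab :: "'a \<Rightarrow> 'b" and I D where
    I: "finite I" "card I \<le> m + 1" "col ` A \<subseteq> I"
    and eq: "\<forall>x\<in>A. \<forall>y\<in>A. dist x y < 2 * r \<longrightarrow> col x = col y \<longrightarrow> lab x = lab y"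
    and D: "\<forall>x\<in>A. \<forall>y\<in>A. lab x = lab y \<longrightarrow> dist x y < D"
    using assms[of "2 * r"] r(1) by (metis mult_pos_pos zero_less_numeral)
  define piece where "piece x = {y \<in> A. lab y = lab x}" for x
  \<comment> \<open>For empty \<open>A\<close> the bound \<open>D\<close> may fail to be positive,
    but a ball entourage needs a positive radius.\<close>
  define d where "d = {(x, y). dist x y < max D 1} \<inter> A \<times> A"
  have d: "d \<in> subspace_coarse (metric_coarse UNIV) A"
    unfolding subspace_coarse_def d_def
    by (intro imageI ball_entourage_in_metric_coarse) simp
  have "mesh (piece ` A) \<subseteq> d"
    using D by (auto simp: mesh_def piece_def d_def less_max_iff_disj)
  moreover have "\<Union> (piece ` A) = A"
    by (auto simp: piece_def)
  moreover have "finite {U \<in> piece ` A. cball_at x e \<inter> U \<noteq> {}} \<and>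
      card {U \<in> piece ` A. cball_at x e \<inter> U \<noteq> {}} \<le> m + 1" if x: "x \<in> A" for x
  proof -
    define near where "near = cball_at x e"
    \<comment> \<open>One representative per colour. If \<open>near\<close> has no point of colour
      \<open>i\<close> the value is arbitrary, which is harmless for an upper bound on the
      count.\<close>
    define pick where "pick i = piece (SOME y. y \<in> near \<and> col y = i)" for i
    have near: "y \<in> A" "dist x y < r" if "y \<in> near" for y
      using that r(2) by (auto simp: near_def cball_at_def e'(2))
    have "{U \<in> piece ` A. near \<inter> U \<noteq> {}} \<subseteq> pick ` I"
    proof
      fix U assume "U \<in> {U \<in> piece ` A. near \<inter> U \<noteq> {}}"
      then obtain x' y where "U = piece x'" "y \<in> near" "y \<in> U" by blast
      then have y: "y \<in> near" "U = piece y"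
        by (auto simp: piece_def)
      define z where "z = (SOME z. z \<in> near \<and> col z = col y)"
      have z: "z \<in> near" "col z = col y"
        unfolding z_def using someI[of "\<lambda>z. z \<in> near \<and> col z = col y" y] y(1) by auto
      have "dist z y < 2 * r"
        using near(2)[OF z(1)] near(2)[OF y(1)] dist_triangle2[of z y x] by (simp add: dist_commute)
      then have "lab z = lab y"
        using eq near z y(1) by blast
      then have "U = pick (col y)"
        unfolding pick_def z_def[symmetric] y(2) by (simp add: piece_def)
      then show "U \<in> pick ` I"
        using I(3) near(1)[OF y(1)] by blast
    qed
    then show ?thesis
      unfolding near_def using I(1,2)
      by (meson finite_surj le_trans surj_card_le)
  qed
  ultimately show "\<exists>\<U>. \<Union> \<U> = A \<and> (\<exists>d\<in>subspace_coarse (metric_coarse UNIV) A. mesh \<U> \<subseteq> d) \<and>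
      (\<forall>x\<in>A. finite {U \<in> \<U>. cball_at x e \<inter> U \<noteq> {}} \<and> card {U \<in> \<U>. cball_at x e \<inter> U \<noteq> {}} \<le> m + 1)"
    using d by blast
qed

section \<open>Lebesgue's covering theorem\<close>

text \<open>
  If every point lay in at most \<open>n\<close> members, a partition of unity would yield a map displacing points
  by at most \<open>D\<close> with image in finitely many simplices of dimension less than \<open>n\<close>; but by Brouwer's
  theorem such a map attains every value near the centre.
\<close>

lemma point_in_many_members_of_cover:
  fixes \<V> :: "'a::euclidean_space set set"
  assumes "D > 0"
    and opn: "\<And>V. V \<in> \<V> \<Longrightarrow> open V"
    and cover: "cball c (2 * D) \<subseteq> \<Union>\<V>"
    and diam: "\<And>V x y. V \<in> \<V> \<Longrightarrow> x \<in> V \<Longrightarrow> y \<in> V \<Longrightarrow> dist x y \<le> D"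
  shows "\<exists>x\<in>cball c (2 * D).
    \<not> (finite {V\<in>\<V>. x \<in> V} \<and> card {V\<in>\<V>. x \<in> V} \<le> DIM('a))"
proof (rule ccontr)
  assume "\<not> ?thesis"
  then have few: "finite {V\<in>\<V>. x \<in> V} \<and> card {V\<in>\<V>. x \<in> V} \<le> DIM('a)" if "x \<in> cball c (2 * D)" for x
    using that by blast
  obtain F where F: "F \<subseteq> \<V>" "finite F" "cball c (2 * D) \<subseteq> \<Union>F"
    using compactE[OF compact_cball cover] opn by blast
  define v where "v V = (SOME x. x \<in> V)" for V :: "'a set"
  have v: "v V \<in> V" if "x \<in> V" for x V
    unfolding v_def using that by (rule someI)
  define \<phi> where "\<phi> V x = infdist x (- V)" for V and x :: 'a
  define \<Phi> where "\<Phi> x = (\<Sum>V\<in>F. \<phi> V x)" for x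
  define f where "f x = (\<Sum>V\<in>F. (\<phi> V x / \<Phi> x) *\<^sub>R v V)" for x
  have \<phi>_nonneg: "\<phi> V x \<ge> 0" for V x
    by (simp add: \<phi>_def infdist_nonneg)
  have \<phi>_zero: "\<phi> V x = 0" if "x \<notin> V" for V x
    using that by (simp add: \<phi>_def)
  have \<phi>_pos: "\<phi> V x > 0" if "V \<in> F" "x \<in> V" for V x
  proof -
    \<comment> \<open>\<open>infdist\<close> to the empty set is 0, so positivity needs a nonempty
      complement, which boundedness of \<open>V\<close> provides.\<close>
    have "V \<subseteq> cball x D" using diam[of V x] that F(1) by auto
    then have "bounded V" using bounded_subset bounded_cball by blast
    then have "- V \<noteq> {}" using not_bounded_UNIV by (metis Compl_empty_eq double_complement)
    then show ?thesis
      unfolding \<phi>_def using opn that F(1) by (intro infdist_pos_not_in_closed) auto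
  qed
  have \<Phi>_pos: "\<Phi> x > 0" if x: "x \<in> cball c (2 * D)" for x
  proof -
    obtain V where "V \<in> F" "x \<in> V" using F(3) x by blast
    then show ?thesis
      unfolding \<Phi>_def using F(2) \<phi>_nonneg \<phi>_pos by (intro sum_pos2[of F V]) auto
  qed
  have f_hull: "f x \<in> convex hull (v ` {V\<in>F. x \<in> V})" if x: "x \<in> cball c (2 * D)" for x
  proof -
    have "f x = (\<Sum>V\<in>{V\<in>F. x \<in> V}. (\<phi> V x / \<Phi> x) *\<^sub>R v V)"
      unfolding f_def using F(2) by (intro sum.mono_neutral_right) (auto simp: \<phi>_zero)
    also have "\<dots> \<in> convex hull (v ` {V\<in>F. x \<in> V})"
    proof (rule convex_sum)
      have "(\<Sum>V\<in>{V\<in>F. x \<in> V}. \<phi> V x) = \<Phi> x"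
        unfolding \<Phi>_def using F(2) by (intro sum.mono_neutral_left) (auto simp: \<phi>_zero)
      then show "(\<Sum>V\<in>{V\<in>F. x \<in> V}. \<phi> V x / \<Phi> x) = 1"
        using \<Phi>_pos[OF x] by (simp flip: sum_divide_distrib)
    qed (use F(2) \<phi>_nonneg \<Phi>_pos[OF x] in \<open>auto intro!: hull_inc divide_nonneg_nonneg\<close>)
    finally show ?thesis .
  qed
  have f_near: "dist x (f x) \<le> D" if x: "x \<in> cball c (2 * D)" for x
  proof -
    have "v ` {V\<in>F. x \<in> V} \<subseteq> cball x D"
      using F(1) diam v by fastforce
    then have "convex hull (v ` {V\<in>F. x \<in> V}) \<subseteq> cball x D"
      by (rule hull_minimal) simp
    with f_hull[OF x] show ?thesis by auto
  qed
  have f_cont: "continuous_on (cball c (2 * D)) f"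
    unfolding f_def \<phi>_def \<Phi>_def
    by (intro continuous_intros) (use \<Phi>_pos in \<open>force simp: \<Phi>_def \<phi>_def\<close>)
  \<comment> \<open>Under \<open>few\<close>, \<open>N\<close> contains all values of
    \<open>f\<close> on the large ball, yet it is null: a hull of at most \<open>DIM('a)\<close>
    points has empty interior.\<close>
  define N where "N = (\<Union>T\<in>{T. T \<subseteq> F \<and> card T \<le> DIM('a)}. convex hull (v ` T))"
  have "negligible N"
    unfolding N_def
  proof (intro negligible_Union)
    show "finite ((\<lambda>T. convex hull (v ` T)) ` {T. T \<subseteq> F \<and> card T \<le> DIM('a)})"
      using F(2) by auto
    fix C assume "C \<in> (\<lambda>T. convex hull (v ` T)) ` {T. T \<subseteq> F \<and> card T \<le> DIM('a)}"
    then obtain T where T: "T \<subseteq> F" "card T \<le> DIM('a)" "C = convex hull (v ` T)" by blast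
    have "finite T" using T(1) F(2) finite_subset by blast
    then have "interior C = {}"
      unfolding T(3) using T(2) card_image_le[of T v] by (intro empty_interior_convex_hull) auto
    then show "negligible C"
      using T(3) by (simp add: negligible_convex_interior)
  qed
  moreover have "\<not> negligible (ball c D)"
    using assms(1) by (intro open_not_negligible) auto
  ultimately obtain y where y: "y \<in> ball c D" "y \<notin> N"
    using negligible_subset by blast
  have sub: "cball y D \<subseteq> cball c (2 * D)"
  proof
    fix z assume "z \<in> cball y D"
    then show "z \<in> cball c (2 * D)"
      using y(1) dist_triangle[of c z y] by simp
  qed
  \<comment> \<open>A fixed point of the map sending \<open>x\<close> to
    \<open>y + (x - f x)\<close> is a preimage of \<open>y\<close>.\<close>
  have "y + (x - f x) \<in> cball y D" if "x \<in> cball y D" for x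
    using f_near[OF subsetD[OF sub that]] by (simp add: dist_norm norm_minus_commute)
  then obtain x where x: "x \<in> cball y D" "f x = y"
    using brouwer_surjective_cball[OF continuous_on_subset[OF f_cont sub] assms(1), of y "{y}"]
    by blast
  have "card {V\<in>F. x \<in> V} \<le> card {V\<in>\<V>. x \<in> V}"
    using few[of x] F(1) x(1) sub by (intro card_mono) auto
  then have "card {V\<in>F. x \<in> V} \<le> DIM('a)"
    using few[of x] x(1) sub by fastforce
  then have "f x \<in> N"
    unfolding N_def using f_hull[OF subsetD[OF sub x(1)]]
    by (intro UN_I[of "{V\<in>F. x \<in> V}"]) simp_all
  then show False
    using x(2) y(2) by simp
qed

section \<open>Grid colourings\<close>

definition nearest_lattice_point :: "'a::euclidean_space \<Rightarrow> 'a" where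
  "nearest_lattice_point x = (\<Sum>b\<in>Basis. of_int (round (x \<bullet> b)) *\<^sub>R b)"

lemma inner_nearest_lattice_point [simp]:
  "b \<in> Basis \<Longrightarrow> nearest_lattice_point x \<bullet> b = of_int (round (x \<bullet> b))"
  by (simp add: nearest_lattice_point_def)

lemma nearest_lattice_point_idem [simp]:
  "nearest_lattice_point (nearest_lattice_point x) = nearest_lattice_point x"
  by (rule euclidean_eqI) simp

lemma nearest_lattice_point_unique:
  assumes "nearest_lattice_point w = w" "norm (x - w) < 1 / 2"
  shows "nearest_lattice_point x = w"
proof (rule euclidean_eqI)
  fix b :: 'a assume b: "b \<in> Basis"
  have w: "w \<bullet> b = of_int (round (w \<bullet> b))"
    using inner_nearest_lattice_point[OF b, of w] assms(1) by simp
  have "\<bar>x \<bullet> b - w \<bullet> b\<bar> < 1 / 2"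
    using Basis_le_norm[OF b, of "x - w"] assms(2) by (simp add: inner_diff_left)
  then have "round (x \<bullet> b) = round (w \<bullet> b)"
    by (intro round_unique') (simp flip: w)
  then show "nearest_lattice_point x \<bullet> b = w \<bullet> b"
    using b w by simp
qed

text \<open>If the floors differed, an integer would separate the two numbers and lie within
  \<open>d\<close> of the smaller one.\<close>

lemma floor_eq_if_far_from_int:
  fixes s t :: real
  assumes "\<bar>s - t\<bar> < d" "\<bar>s - of_int (round s)\<bar> \<ge> d" "\<bar>t - of_int (round t)\<bar> \<ge> d"
  shows "\<lfloor>s\<rfloor> = \<lfloor>t\<rfloor>"
proof -
  have *: "\<lfloor>b\<rfloor> \<le> \<lfloor>a\<rfloor>" if "\<bar>a - b\<bar> < d" "\<bar>a - of_int (round a)\<bar> \<ge> d" for a b :: real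
  proof (rule ccontr)
    assume "\<not> \<lfloor>b\<rfloor> \<le> \<lfloor>a\<rfloor>"
    then have "a < of_int \<lfloor>b\<rfloor>" "of_int \<lfloor>b\<rfloor> \<le> b"
      by linarith+
    then have "\<bar>a - of_int \<lfloor>b\<rfloor>\<bar> < d" using that(1) by linarith
    then show False using round_diff_minimal[of a "\<lfloor>b\<rfloor>"] that(2) by linarith
  qed
  show ?thesis
    using *[of s t] *[of t s] assms by (simp add: abs_minus_commute)
qed

text \<open>In each coordinate the label records either the nearby integer or the unit interval, so
  it names the cell. The bound on \<open>d\<close> keeps every threshold, enlarged by
  \<open>d\<close>, below \<open>1 / 2\<close>, where rounding is stable.\<close>

lemma grid_colouring:
  fixes d :: real
  assumes "d > 0" "2 * (real DIM('a) + 2) * d < 1"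
  shows "\<exists>(col :: 'a::euclidean_space \<Rightarrow> nat) (lab :: 'a \<Rightarrow> 'a set \<times> ('a \<Rightarrow> int)).
    (\<forall>x. col x \<le> DIM('a)) \<and>
    (\<forall>x y. dist x y < d \<longrightarrow> col x = col y \<longrightarrow> lab x = lab y) \<and>
    (\<forall>x y. lab x = lab y \<longrightarrow> dist x y \<le> real DIM('a)) \<and>
    (\<forall>x. col x = 0 \<longrightarrow>
      norm (x - nearest_lattice_point x) \<le> real DIM('a) * (real DIM('a) + 1) * d)"
proof -
  define n where "n = DIM('a)"
  define t where "t s = \<bar>s - of_int (round s)\<bar>" for s :: real
  \<comment> \<open>The drop by \<open>d\<close> per dimension is what separates neighbourhoods of
    distinct cells of equal dimension.\<close>
  define r where "r i = (real n + 1 - real i) * d" for i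
  define J where "J i x = {b\<in>Basis. t (x \<bullet> b) \<le> r i}" for i and x :: 'a
  \<comment> \<open>\<open>x\<close> is within \<open>r i\<close> of the \<open>i\<close>-skeleton in the sup norm iff \<open>J i x\<close> has at least \<open>n - i\<close> elements\<close>
  define col where "col x = (LEAST i. n - i \<le> card (J i x))" for x
  \<comment> \<open>The default 0 off \<open>Basis\<close> makes equality of labels depend on basis
    coordinates only.\<close>
  define lab where "lab x = (J (col x) x, \<lambda>b. if b \<notin> Basis then 0 else
      if b \<in> J (col x) x then round (x \<bullet> b) else \<lfloor>x \<bullet> b\<rfloor>)" for x
  have finJ [simp]: "finite (J i x)" for i x by (simp add: J_def)
  have col_le: "col x \<le> n" for x
    unfolding col_def by (rule Least_le) simp
  have col_card: "n - col x \<le> card (J (col x) x)" for x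
    unfolding col_def by (rule LeastI[of _ n]) simp
  have J0: "J 0 x = Basis" if "col x = 0" for x
    using col_card[of x] that by (intro card_seteq) (auto simp: J_def n_def)
  \<comment> \<open>minimality of \<open>col x\<close>: the coordinates outside \<open>J\<close> miss the threshold by at least \<open>d\<close>\<close>
  have gap: "t (x \<bullet> b) > r (col x) + d" if b: "b \<in> Basis" "b \<notin> J (col x) x" for x b
  proof (cases "col x")
    case 0
    then show ?thesis using J0 b by auto
  next
    case (Suc k)
    then have "\<not> n - k \<le> card (J k x)"
      unfolding col_def by (metis lessI not_less_Least)
    \<comment> \<open>Fewer than \<open>n - k\<close> means at most \<open>n - Suc k\<close>, the
      lower bound for \<open>card (J (col x) x)\<close>.\<close>
    then have "card (J k x) \<le> card (J (col x) x)"
      using col_card[of x] Suc by linarith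
    moreover have r: "r k = r (col x) + d"
      by (simp add: r_def Suc algebra_simps)
    then have "J (col x) x \<subseteq> J k x"
      using assms(1) by (auto simp: J_def)
    ultimately have "J (col x) x = J k x"
      by (intro card_seteq) auto
    then show ?thesis using b r by (auto simp: J_def)
  qed
  have r_bounds: "d \<le> r (col x)" "r (col x) + d < 1 / 2" for x
  proof -
    have "1 * d \<le> r (col x)"
      unfolding r_def using col_le[of x] assms(1) by (intro mult_right_mono) auto
    then show "d \<le> r (col x)" by simp
    have "r (col x) \<le> (real n + 1) * d"
      unfolding r_def using assms(1) by (intro mult_right_mono) auto
    then show "r (col x) + d < 1 / 2"
      using assms(2) unfolding n_def by (simp add: algebra_simps)
  qed
  have t_lip: "t s \<le> t u + \<bar>s - u\<bar>" for s u
    using round_diff_minimal[of s "round u"] unfolding t_def by linarith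
  have coord: "\<bar>x \<bullet> b - y \<bullet> b\<bar> < d" if "dist x y < d" "b \<in> Basis" for x y b :: 'a
    using Basis_le_norm[OF that(2), of "x - y"] that(1) by (simp add: inner_diff_left dist_norm)
  \<comment> \<open>A move of less than \<open>d\<close> cannot carry a coordinate across the
    gap.\<close>
  have J_sub: "J (col x) x \<subseteq> J (col y) y" if "dist x y < d" "col x = col y" for x y
  proof
    fix b assume "b \<in> J (col x) x"
    then have b: "b \<in> Basis" "t (x \<bullet> b) \<le> r (col y)" using that(2) by (auto simp: J_def)
    then have "t (y \<bullet> b) \<le> r (col y) + d"
      using t_lip[of "y \<bullet> b" "x \<bullet> b"] coord[OF that(1) b(1)] by linarith
    then show "b \<in> J (col y) y" using gap[OF b(1), of y] by fastforce
  qed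
  show ?thesis
  proof (intro exI[of _ col] exI[of _ lab] conjI allI impI)
    show "col x \<le> DIM('a)" for x using col_le n_def by simp
    show "lab x = lab y" if "dist x y < d" "col x = col y" for x y
    proof -
      have Jeq: "J (col x) x = J (col y) y"
        using J_sub[of x y] J_sub[of y x] that by (auto simp: dist_commute)
      have "round (x \<bullet> b) = round (y \<bullet> b)" if b: "b \<in> Basis" "b \<in> J (col x) x" for b
      proof -
        have "\<bar>x \<bullet> b - of_int (round (x \<bullet> b))\<bar> \<le> r (col x)"
          using b by (simp add: J_def t_def)
        then have "\<bar>y \<bullet> b - of_int (round (x \<bullet> b))\<bar> < 1 / 2"
          using coord[OF \<open>dist x y < d\<close> b(1)] r_bounds(2)[of x] by linarith
        then show ?thesis using round_unique' by metis
      qed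
      moreover have "\<lfloor>x \<bullet> b\<rfloor> = \<lfloor>y \<bullet> b\<rfloor>" if b: "b \<in> Basis" "b \<notin> J (col x) x" for b
        using coord[OF \<open>dist x y < d\<close> b(1)] gap[OF b] gap[of b y] b Jeq assms(1)
          r_bounds(1)[of x] r_bounds(1)[of y]
        by (intro floor_eq_if_far_from_int[where d = d]) (auto simp: t_def)
      ultimately show ?thesis
        unfolding lab_def using Jeq by auto
    qed
    show "dist x y \<le> real DIM('a)" if "lab x = lab y" for x y
    proof -
      have Jeq: "J (col x) x = J (col y) y" using that by (simp add: lab_def)
      have "\<bar>(x - y) \<bullet> b\<bar> \<le> 1" if b: "b \<in> Basis" for b
      proof (cases "b \<in> J (col x) x")
        case True
        then have "round (x \<bullet> b) = round (y \<bullet> b)"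
          using fun_cong[OF arg_cong[OF \<open>lab x = lab y\<close>, of snd], of b] b Jeq by (simp add: lab_def)
        then show ?thesis
          using round_eq_imp_diff_1[of "x \<bullet> b" "y \<bullet> b"] by (simp add: inner_diff_left)
      next
        case False
        then have "\<lfloor>x \<bullet> b\<rfloor> = \<lfloor>y \<bullet> b\<rfloor>"
          using fun_cong[OF arg_cong[OF \<open>lab x = lab y\<close>, of snd], of b] b Jeq by (simp add: lab_def)
        then show ?thesis
          unfolding inner_diff_left by linarith
      qed
      then have "(\<Sum>b\<in>Basis. \<bar>(x - y) \<bullet> b\<bar>) \<le> of_nat (card (Basis :: 'a set)) * 1"
        by (intro sum_bounded_above) auto
      then show ?thesis
        using norm_le_l1[of "x - y"] by (simp add: dist_norm)
    qed
    show "norm (x - nearest_lattice_point x) \<le> real DIM('a) * (real DIM('a) + 1) * d"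
      if "col x = 0" for x
    proof -
      have "\<bar>(x - nearest_lattice_point x) \<bullet> b\<bar> \<le> r 0" if b: "b \<in> Basis" for b
        using J0[OF \<open>col x = 0\<close>] b by (auto simp: J_def t_def inner_diff_left)
      then have "(\<Sum>b\<in>Basis. \<bar>(x - nearest_lattice_point x) \<bullet> b\<bar>) \<le> of_nat (card (Basis :: 'a set)) * r 0"
        by (intro sum_bounded_above) auto
      then show ?thesis
        using norm_le_l1[of "x - nearest_lattice_point x"] by (simp add: r_def n_def)
    qed
  qed
qed

text \<open>Near each point \<open>v\<close> of the lattice of spacing \<open>8 * K\<close>,
  \<open>h\<close> is the translation taking \<open>c v\<close> to \<open>v\<close>; it fades out
  linearly between distances \<open>K\<close> and \<open>2 * K\<close>. The translation has length
  at most \<open>S < K\<close>, so fading costs at most a factor 2.\<close>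

lemma move_points_to_lattice:
  fixes c :: "'a::euclidean_space \<Rightarrow> 'a"
  assumes "S > 0" "R > 0" "e > 0" and c: "\<And>x. dist x (c x) \<le> S"
    and K: "K = R + S + e"
  shows "\<exists>h. (\<forall>x. dist x (h x) \<le> S) \<and>
    (\<forall>x y. dist x y < e \<longrightarrow> dist (h x) (h y) \<le> 2 * dist x y) \<and>
    (\<forall>x w. nearest_lattice_point w = w \<longrightarrow> dist (h x) ((8 * K) *\<^sub>R w) \<le> R \<longrightarrow>
      dist x (c ((8 * K) *\<^sub>R w)) \<le> R)"
proof -
  define M where "M = 8 * K"
  have pos: "K > 0" "M > 0" using assms K by (auto simp: M_def)
  define v where "v x = M *\<^sub>R nearest_lattice_point (x /\<^sub>R M)" for x :: 'a
  define \<phi> where "\<phi> x = max 0 (min 1 (2 - dist x (v x) / K))" for x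
  define h where "h x = x + \<phi> x *\<^sub>R (v x - c (v x))" for x
  have v_unique: "v x = M *\<^sub>R w" if "nearest_lattice_point w = w" "dist x (M *\<^sub>R w) < 4 * K" for x w
  proof -
    have "x /\<^sub>R M - w = (x - M *\<^sub>R w) /\<^sub>R M"
      using pos by (simp add: algebra_simps)
    then have "norm (x /\<^sub>R M - w) = dist x (M *\<^sub>R w) / M"
      using pos by (simp add: dist_norm divide_inverse mult.commute)
    then have "norm (x /\<^sub>R M - w) < 1 / 2"
      using that(2) pos by (simp add: M_def)
    then show ?thesis
      unfolding v_def using nearest_lattice_point_unique[OF that(1)] by simp
  qed
  have v_near: "v y = v x" if "dist y (v x) < 4 * K" for x y
    using v_unique[of "nearest_lattice_point (x /\<^sub>R M)" y] that by (simp add: v_def)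
  have \<phi>_range: "0 \<le> \<phi> x" "\<phi> x \<le> 1" for x by (auto simp: \<phi>_def)
  have shift: "norm (v x - c (v x)) \<le> S" for x
    using c[of "v x"] by (simp add: dist_norm)
  show ?thesis
  proof (intro exI[of _ h] conjI allI impI)
    show h_near: "dist x (h x) \<le> S" for x
    proof -
      have "\<phi> x * norm (v x - c (v x)) \<le> 1 * S"
        using \<phi>_range shift by (intro mult_mono) auto
      then show ?thesis using \<phi>_range(1)[of x] by (simp add: h_def dist_norm)
    qed
    show "dist (h x) (h y) \<le> 2 * dist x y" if xy: "dist x y < e" for x y
    proof (cases "v x = v y")
      case True
      have "\<bar>\<phi> x - \<phi> y\<bar> \<le> \<bar>dist x (v x) / K - dist y (v x) / K\<bar>"
        unfolding \<phi>_def True by linarith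
      also have "\<dots> = \<bar>dist x (v x) - dist y (v x)\<bar> / K"
        using pos by (simp add: diff_divide_distrib[symmetric])
      also have "\<dots> \<le> dist x y / K"
        using pos dist_triangle[of x "v x" y] dist_triangle[of y "v x" x]
        by (intro divide_right_mono) (auto simp: dist_commute abs_le_iff)
      finally have "\<bar>\<phi> x - \<phi> y\<bar> * norm (v x - c (v x)) \<le> dist x y / K * K"
        using shift[of x] assms pos by (intro mult_mono) (auto simp: K)
      then have "norm ((\<phi> x - \<phi> y) *\<^sub>R (v x - c (v x))) \<le> dist x y"
        using pos by simp
      moreover have "h x - h y = (x - y) + (\<phi> x - \<phi> y) *\<^sub>R (v x - c (v x))"
        by (simp add: h_def True algebra_simps)
      ultimately show ?thesis
        using norm_triangle_ineq[of "x - y" "(\<phi> x - \<phi> y) *\<^sub>R (v x - c (v x))"]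
        by (simp add: dist_norm)
    next
      case False
      \<comment> \<open>Were \<open>\<phi> a\<close> nonzero, \<open>a\<close> would be within
        \<open>2 * K\<close> of \<open>v a\<close> and \<open>b\<close> within \<open>4 * K\<close>,
        forcing \<open>v b = v a\<close>.\<close>
      have zero: "\<phi> a = 0" if "dist a b < e" "v a \<noteq> v b" for a b
      proof -
        have "\<not> dist b (v a) < 4 * K" using v_near[of b a] that(2) by metis
        then have "dist a (v a) \<ge> 2 * K"
          using dist_triangle[of b "v a" a] that(1) assms K by (simp add: dist_commute)
        then show ?thesis using pos by (simp add: \<phi>_def field_simps)
      qed
      show ?thesis
        using zero[of x y] zero[of y x] False xy by (auto simp: h_def dist_commute)
    qed
    show "dist x (c ((8 * K) *\<^sub>R w)) \<le> R"
      if w: "nearest_lattice_point w = w" "dist (h x) ((8 * K) *\<^sub>R w) \<le> R" for x w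
    proof -
      \<comment> \<open>As \<open>h\<close> moves \<open>x\<close> by at most \<open>S\<close>, the
        point \<open>x\<close> lies where \<open>\<phi>\<close> is 1 and \<open>h\<close> is a pure
        translation.\<close>
      have "dist x (M *\<^sub>R w) \<le> R + S"
        using w(2) h_near[of x] dist_triangle[of x "M *\<^sub>R w" "h x"] by (simp add: M_def)
      then have le: "dist x (M *\<^sub>R w) \<le> K" using K assms by simp
      then have v: "v x = M *\<^sub>R w" using v_unique[OF w(1), of x] pos by simp
      then have "\<phi> x = 1" using le pos by (simp add: \<phi>_def field_simps)
      then have "h x - M *\<^sub>R w = x - c (M *\<^sub>R w)" by (simp add: h_def v)
      then show ?thesis using w(2) by (simp add: dist_norm M_def)
    qed
  qed
qed

section \<open>Small subsets of Euclidean spaces\<close>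

text \<open>Rescaling turns the given scale \<open>r\<close> into the separation \<open>d\<close> of
  the grid colouring.\<close>

lemma asdim_le_UNIV:
  "asdim_le (UNIV :: 'a::euclidean_space set) (metric_coarse UNIV) DIM('a)"
proof -
  have "asdim_le (UNIV :: 'a set) (subspace_coarse (metric_coarse UNIV) UNIV) DIM('a)"
  proof (rule asdim_le_metric_subspaceI[where 'b = "'a set \<times> ('a \<Rightarrow> int)"])
    fix r :: real assume r: "r > 0"
    define d where "d = 1 / (4 * (real DIM('a) + 2))"
    have d: "d > 0" "2 * (real DIM('a) + 2) * d < 1"
      by (auto simp: d_def field_simps intro: add_nonneg_pos)
    obtain col :: "'a \<Rightarrow> nat" and lab :: "'a \<Rightarrow> 'a set \<times> ('a \<Rightarrow> int)" where
      cl: "\<And>x. col x \<le> DIM('a)"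
        "\<And>x y. dist x y < d \<Longrightarrow> col x = col y \<Longrightarrow> lab x = lab y"
        "\<And>x y. lab x = lab y \<Longrightarrow> dist x y \<le> real DIM('a)"
      using grid_colouring[OF d] by blast
    define s where "s = d / r"
    have s: "s > 0" using d r by (simp add: s_def)
    have scale: "dist (s *\<^sub>R x) (s *\<^sub>R y) = s * dist x y" for x y :: 'a
      using s by (simp add: dist_norm flip: scaleR_diff_right)
    show "\<exists>(col :: 'a \<Rightarrow> nat) (lab :: 'a \<Rightarrow> 'a set \<times> ('a \<Rightarrow> int)) I D.
        finite I \<and> card I \<le> DIM('a) + 1 \<and> col ` UNIV \<subseteq> I \<and>
        (\<forall>x\<in>UNIV. \<forall>y\<in>UNIV. dist x y < r \<longrightarrow> col x = col y \<longrightarrow> lab x = lab y) \<and>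
        (\<forall>x\<in>UNIV. \<forall>y\<in>UNIV. lab x = lab y \<longrightarrow> dist x y < D)"
    proof (intro exI conjI ballI impI)
      show "finite {..DIM('a)}" "card {..DIM('a)} \<le> DIM('a) + 1" by simp_all
      show "range (\<lambda>x. col (s *\<^sub>R x)) \<subseteq> {..DIM('a)}" using cl(1) by auto
      show "lab (s *\<^sub>R x) = lab (s *\<^sub>R y)" if "dist x y < r" "col (s *\<^sub>R x) = col (s *\<^sub>R y)" for x y
      proof (rule cl(2))
        have "s * dist x y < s * r" using that(1) s by simp
        then show "dist (s *\<^sub>R x) (s *\<^sub>R y) < d"
          unfolding scale using r by (simp add: s_def)
      qed fact
      show "dist x y < real DIM('a) / s + 1" if "lab (s *\<^sub>R x) = lab (s *\<^sub>R y)" for x y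
        using cl(3)[OF that] s unfolding scale by (simp add: field_simps)
    qed
  qed
  then show ?thesis by simp
qed

lemma porous_imp_asdim_le:
  fixes A :: "'a::euclidean_space set"
  assumes porous: "\<And>R. R > 0 \<Longrightarrow> \<exists>S>0. \<forall>x. \<exists>y. dist x y < S \<and> ball y R \<inter> A = {}"
  shows "asdim_le A (subspace_coarse (metric_coarse UNIV) A) (DIM('a) - 1)"
proof (rule asdim_le_metric_subspaceI[where 'b = "'a set \<times> ('a \<Rightarrow> int)"])
  fix e :: real assume e: "e > 0"
  \<comment> \<open>This is the colour 0 bound of the grid for \<open>d = 2 * e / M\<close>,
    multiplied by \<open>M\<close>. It does not depend on \<open>M\<close>, so it can be fixed
    before \<open>S\<close> and \<open>M\<close>.\<close>
  define R where "R = 2 * e * real DIM('a) * (real DIM('a) + 1)"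
  have R: "R > 0" using e by (simp add: R_def add_nonneg_pos)
  \<comment> \<open>The factor 2 leaves room for the non-strict bound \<open>R\<close> in
    \<open>h_lattice\<close>.\<close>
  obtain S where S: "S > 0" "\<And>x. \<exists>y. dist x y < S \<and> ball y (2 * R) \<inter> A = {}"
    using porous[of "2 * R"] R by auto
  then obtain c where c: "\<And>x. dist x (c x) < S" "\<And>x. ball (c x) (2 * R) \<inter> A = {}"
    by metis
  define K where "K = R + S + e"
  define M where "M = 8 * K"
  have M: "M > 0" using R S e by (simp add: M_def K_def)
  obtain h where h_near: "\<And>x. dist x (h x) \<le> S"
    and h_lip: "\<And>x y. dist x y < e \<Longrightarrow> dist (h x) (h y) \<le> 2 * dist x y"
    and h_lattice: "\<And>x w. nearest_lattice_point w = w \<Longrightarrow> dist (h x) (M *\<^sub>R w) \<le> R \<Longrightarrow>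
           dist x (c (M *\<^sub>R w)) \<le> R"
    using move_points_to_lattice[OF S(1) R e less_imp_le[OF c(1)] K_def] unfolding M_def by blast
  \<comment> \<open>\<open>h\<close> at most doubles distances below \<open>e\<close>, and division
    by \<open>M\<close> follows.\<close>
  define d where "d = 2 * e / M"
  have d: "d > 0" using e M by (simp add: d_def)
  have "2 * (real DIM('a) + 2) * (2 * e) < M"
  proof -
    have "2 * e * real DIM('a) * 1 \<le> R"
      unfolding R_def using e by (intro mult_left_mono) auto
    then have "M \<ge> 16 * (e * real DIM('a)) + 8 * S + 8 * e"
      by (simp add: M_def K_def)
    moreover have "e * real DIM('a) > 0" using e by simp
    ultimately show ?thesis
      using S(1) by (simp add: algebra_simps)
  qed
  then have d_small: "2 * (real DIM('a) + 2) * d < 1"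
    using M by (simp add: d_def field_simps)
  obtain col :: "'a \<Rightarrow> nat" and lab :: "'a \<Rightarrow> 'a set \<times> ('a \<Rightarrow> int)" where
    cl: "\<And>x. col x \<le> DIM('a)"
      "\<And>x y. dist x y < d \<Longrightarrow> col x = col y \<Longrightarrow> lab x = lab y"
      "\<And>x y. lab x = lab y \<Longrightarrow> dist x y \<le> real DIM('a)"
      "\<And>x. col x = 0 \<Longrightarrow> norm (x - nearest_lattice_point x) \<le> real DIM('a) * (real DIM('a) + 1) * d"
    using grid_colouring[OF d d_small] by blast
  have scale: "dist (a /\<^sub>R M) (b /\<^sub>R M) = dist a b / M" for a b :: 'a
    using M by (simp add: dist_norm divide_inverse mult.commute flip: scaleR_diff_right)
  show "\<exists>(col :: 'a \<Rightarrow> nat) (lab :: 'a \<Rightarrow> 'a set \<times> ('a \<Rightarrow> int)) I D.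
        finite I \<and> card I \<le> DIM('a) - 1 + 1 \<and> col ` A \<subseteq> I \<and>
        (\<forall>x\<in>A. \<forall>y\<in>A. dist x y < e \<longrightarrow> col x = col y \<longrightarrow> lab x = lab y) \<and>
        (\<forall>x\<in>A. \<forall>y\<in>A. lab x = lab y \<longrightarrow> dist x y < D)"
  proof (intro exI conjI ballI impI)
    show "finite {1..DIM('a)}" "card {1..DIM('a)} \<le> DIM('a) - 1 + 1" by simp_all
    \<comment> \<open>Colour 0 would put \<open>h x\<close> within \<open>R\<close> of a lattice
      vertex, hence \<open>x\<close> into a hole of \<open>A\<close>.\<close>
    have "col (h x /\<^sub>R M) \<noteq> 0" if "x \<in> A" for x
    proof
      define w where "w = nearest_lattice_point (h x /\<^sub>R M)"
      assume "col (h x /\<^sub>R M) = 0"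
      from cl(4)[OF this] have "dist (h x /\<^sub>R M) ((M *\<^sub>R w) /\<^sub>R M) \<le> R / M"
        using M by (simp add: w_def dist_norm R_def d_def mult_ac)
      then have "dist (h x) (M *\<^sub>R w) \<le> R"
        unfolding scale using M by (simp add: divide_le_cancel)
      then have "dist x (c (M *\<^sub>R w)) \<le> R"
        by (intro h_lattice) (simp_all add: w_def)
      then have "x \<in> ball (c (M *\<^sub>R w)) (2 * R)" using R by (simp add: dist_commute)
      then show False using c(2) that by blast
    qed
    then show "(\<lambda>x. col (h x /\<^sub>R M)) ` A \<subseteq> {1..DIM('a)}"
      using cl(1) by (force simp: Suc_le_eq)
    show "lab (h x /\<^sub>R M) = lab (h y /\<^sub>R M)"
      if "dist x y < e" "col (h x /\<^sub>R M) = col (h y /\<^sub>R M)" for x y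
    proof (rule cl(2))
      show "dist (h x /\<^sub>R M) (h y /\<^sub>R M) < d"
        unfolding scale d_def using h_lip[OF that(1)] that(1) M by (intro divide_strict_right_mono) auto
    qed fact
    show "dist x y < real DIM('a) * M + 2 * S + 1" if "lab (h x /\<^sub>R M) = lab (h y /\<^sub>R M)" for x y
    proof -
      have "dist (h x) (h y) \<le> real DIM('a) * M"
        using cl(3)[OF that] M unfolding scale by (simp add: field_simps)
      then show ?thesis
        using h_near[of x] h_near[of y] dist_triangle[of x y "h x"] dist_triangle[of "h x" y "h y"]
        by (simp add: dist_commute)
    qed
  qed
qed

lemma asdim_le_imp_porous:
  fixes A :: "'a::euclidean_space set"
  assumes A: "asdim_le A (subspace_coarse (metric_coarse UNIV) A) (DIM('a) - 1)" and R: "R > 0"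
  shows "\<exists>S>0. \<forall>x. \<exists>y. dist x y < S \<and> ball y R \<inter> A = {}"
proof (rule ccontr)
  assume "\<not> ?thesis"
  then have dense: "\<exists>x. \<forall>y. dist x y < S \<longrightarrow> ball y R \<inter> A \<noteq> {}" if "S > 0" for S
    using that by blast
  \<comment> \<open>Members whose \<open>R\<close>-fattening contains \<open>y\<close> all meet the
    \<open>2 * R\<close>-ball about any point of \<open>A\<close> within \<open>R\<close> of
    \<open>y\<close>.\<close>
  have "2 * R > 0" using R by simp
  then obtain \<U> D where D: "D > 0" and \<U>: "\<Union>\<U> = A"
    and mesh: "\<forall>U\<in>\<U>. \<forall>x\<in>U. \<forall>y\<in>U. dist x y < D"
    and count: "\<forall>x\<in>A. finite {U\<in>\<U>. ball x (2 * R) \<inter> U \<noteq> {}} \<and>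
                  card {U\<in>\<U>. ball x (2 * R) \<inter> U \<noteq> {}} \<le> DIM('a) - 1 + 1"
    using asdim_le_metric_subspaceD[OF A, of "2 * R"] by (elim exE conjE meta_impE) blast+
  define D' where "D' = D + 2 * R"
  have D': "D' > 0" using D R by (simp add: D'_def)
  \<comment> \<open>The extra 1 lets the strict inequality include the closed ball of radius
    \<open>2 * D'\<close>.\<close>
  obtain c where c: "\<And>y. dist c y < 2 * D' + 1 \<Longrightarrow> ball y R \<inter> A \<noteq> {}"
    using dense[of "2 * D' + 1"] D' by auto
  define fat where "fat U = (\<Union>a\<in>U. ball a R)" for U :: "'a set"
  have near: "\<exists>a\<in>A. dist a y < R" if "y \<in> cball c (2 * D')" for y
    using c[of y] that by (fastforce simp: dist_commute)
  have "\<exists>y\<in>cball c (2 * D').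
    \<not> (finite {V\<in>fat ` \<U>. y \<in> V} \<and> card {V\<in>fat ` \<U>. y \<in> V} \<le> DIM('a))"
  proof (rule point_in_many_members_of_cover[OF D'])
    show "open V" if "V \<in> fat ` \<U>" for V
      using that by (auto simp: fat_def)
    show "cball c (2 * D') \<subseteq> \<Union> (fat ` \<U>)"
    proof
      fix y assume "y \<in> cball c (2 * D')"
      then obtain a where "a \<in> A" "dist a y < R" using near by blast
      then show "y \<in> \<Union> (fat ` \<U>)" using \<U> by (auto simp: fat_def)
    qed
    show "dist x y \<le> D'" if V: "V \<in> fat ` \<U>" "x \<in> V" "y \<in> V" for V x y
    proof -
      obtain U a b where U: "U \<in> \<U>" "a \<in> U" "b \<in> U" and "dist a x < R" "dist b y < R"
        using V by (auto simp: fat_def)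
      moreover have "dist a b < D" using mesh U by blast
      ultimately show ?thesis
        using dist_triangle[of x y a] dist_triangle[of a y b]
        by (simp add: D'_def dist_commute)
    qed
  qed
  then obtain y where y: "y \<in> cball c (2 * D')"
    and many: "\<not> (finite {V\<in>fat ` \<U>. y \<in> V} \<and> card {V\<in>fat ` \<U>. y \<in> V} \<le> DIM('a))"
    by blast
  obtain a where a: "a \<in> A" "dist a y < R" using near[OF y] by blast
  have "{V\<in>fat ` \<U>. y \<in> V} \<subseteq> fat ` {U\<in>\<U>. ball a (2 * R) \<inter> U \<noteq> {}}"
  proof
    fix V assume "V \<in> {V\<in>fat ` \<U>. y \<in> V}"
    then obtain U b where U: "U \<in> \<U>" "V = fat U" "b \<in> U" "dist b y < R"
      by (auto simp: fat_def)
    then have "b \<in> ball a (2 * R)"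
      using a(2) dist_triangle2[of a b y] by simp
    then show "V \<in> fat ` {U\<in>\<U>. ball a (2 * R) \<inter> U \<noteq> {}}" using U by blast
  qed
  moreover have "DIM('a) - 1 + 1 = DIM('a)"
    using DIM_positive[where 'a='a] by linarith
  ultimately show False
    using many bspec[OF count a(1)]
    by (metis (no_types, lifting) finite_surj le_trans surj_card_le)
qed

lemma small_sets_euclidean_iff:
  fixes A :: "'a::euclidean_space set"
  shows "A \<in> small_sets UNIV (metric_coarse UNIV) \<longleftrightarrow>
    asdim_le A (subspace_coarse (metric_coarse UNIV) A) (DIM('a) - 1)"
  unfolding small_sets_metric_iff using porous_imp_asdim_le asdim_le_imp_porous by blast

text \<open>The upper bound is the grid colouring. For the lower bound, the whole space has no
  holes, so it is not small, and the characterisation applies with \<open>A = UNIV\<close>.\<close>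

lemma asdim_euclidean: "asdim (UNIV :: 'a::euclidean_space set) (metric_coarse UNIV) = enat DIM('a)"
proof (rule antisym)
  have "asdim (UNIV :: 'a set) (metric_coarse UNIV) < enat (DIM('a) + 1)"
    by (subst asdim_less_iff) (simp_all add: asdim_le_UNIV)
  then show "asdim (UNIV :: 'a set) (metric_coarse UNIV) \<le> enat DIM('a)"
    by (cases "asdim (UNIV :: 'a set) (metric_coarse UNIV)") auto
  have "(UNIV :: 'a set) \<notin> small_sets UNIV (metric_coarse UNIV)"
    by (auto simp: small_sets_metric_iff intro!: exI[of _ 1])
  then have "\<not> asdim (UNIV :: 'a set) (metric_coarse UNIV) < enat DIM('a)"
    unfolding small_sets_euclidean_iff by (simp add: asdim_less_iff)
  then show "enat DIM('a) \<le> asdim (UNIV :: 'a set) (metric_coarse UNIV)"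
    by simp
qed

theorem theorem1p2:
  "small_sets (UNIV :: (real ^ 'n) set) (metric_coarse UNIV)
     = D_less (UNIV :: (real ^ 'n) set) (metric_coarse UNIV)"
  unfolding D_less_def asdim_euclidean
  \<comment> \<open>Without \<open>DIM_cart\<close> the dimension stays in the form
    \<open>DIM\<close>, whose positivity is the side condition of
    \<open>asdim_less_iff\<close>.\<close>
  by (rule set_eqI) (simp add: small_sets_euclidean_iff asdim_less_iff del: DIM_cart)

end
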